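(* Let $(I\times\Omega,\mathcal I\boxtimes\mathcal F,\lambda\boxtimes P)$ be a Fubini extension, let $\mathcal C$ be a countably generated sub-$\sigma$-algebra of $\mathcal F$, and let $f$ be a process from $(I\times\Omega,\mathcal I\boxtimes\mathcal F,\lambda\boxtimes P)$ to a Polish space $X$. If $f$ has no coalitional individual uncertainty in aggregation given $\mathcal C$, then $f$ is essentially pairwise conditionally independent given $\mathcal C$.
   Context: All probability spaces are countably additive and complete. $(I,\mathcal I,\lambda)$ is an atomless probability space and $(\Omega,\mathcal F,P)$ is a probability space. A probability space $(I\times\Omega,\mathcal W,Q)$ extending the usual product space $(I\times\Omega,\mathcal I\otimes\mathcal F,\lambda\otimes P)$ is a Fubini extension if for every real-valued $Q$-integrable function $h$ on $(I\times\Omega,\mathcal W)$: (1) $h_i=h(i,\cdot)$ is integrable on $(\Omega,\mathcal F,P)$ for $\lambda$-almost all $i$, and $h_\omega=h(\cdot,\omega)$ is integrable on $(I,\mathcal I,\lambda)$ for $P$-almost all $\omega$; (2) $i\mapsto\int_\Omega h_i\,dP$ and $\omega\mapsto\int_I h_\omega\,d\lambda$ are integrable on $(I,\mathcal I,\lambda)$ and $(\Omega,\mathcal F,P)$ respectively, and $\int h\,dQ=\int_I\int_\Omega h_i\,dP\,d\lambda=\int_\Omega\int_I h_\omega\,d\lambda\,dP$. It is then denoted $(I\times\Omega,\mathcal I\boxtimes\mathcal F,\lambda\boxtimes P)$. Sub-$\sigma$-algebras $\mathcal C$ of $\mathcal F$ are assumed to contain all $P$-null sets of $\mathcal F$; "countably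 generated" means generated by a countable family of sets together with the $P$-null sets. A process from the Fubini extension to a Polish space $X$ (with Borel $\sigma$-algebra $\mathcal B$) is an $\mathcal I\boxtimes\mathcal F$-measurable map $f:I\times\Omega\to X$; write $f_i=f(i,\cdot)$, $f_\omega=f(\cdot,\omega)$. Random variables $\phi,\psi:\Omega\to X$ are conditionally independent given $\mathcal C$ if $P(\phi^{-1}(B_1)\cap\psi^{-1}(B_2)|\mathcal C)=P(\phi^{-1}(B_1)|\mathcal C)P(\psi^{-1}(B_2)|\mathcal C)$ for all $B_1,B_2\in\mathcal B$. The process $f$ is essentially pairwise conditionally independent given $\mathcal C$ if for $\lambda$-almost all $i_1\in I$, $f_{i_1}$ and $f_{i_2}$ are conditionally independent given $\mathcal C$ for $\lambda$-almost all $i_2\in I$. Let $\mu$ be a regular conditional distribution of $f$ given $\mathcal I\otimes\mathcal C$ (on the probability space $(I\times\Omega,\mathcal I\boxtimes\mathcal F,\lambda\boxtimes P)$), with value $\mu_{i\omega}$ at $(i,\omega)$, a Borel probability measure on $X$. The process $f$ has no coalitional individual uncertainty in aggregation given $\mathcal C$ if for any $A\in\mathcal I$ and for $P$-almost all $\omega\in\Omega$, $\lambda((f^A_\omega)^{-1}(B))=\int_A\mu_{i\omega}(B)\,d\lambda(i)$ for every Borel set $B$ in $X$, where $f^A$ is the restriction of $f$ to $A\times\Omega$ and $f^A_\omega=f^A(\cdot,\omega):A\to X$. *)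

theory Defs
  imports "HOL-Probability.Probability"
begin

definition atomless :: "'a measure \<Rightarrow> bool" where
  "atomless M \<longleftrightarrow>
    (\<forall>A\<in>sets M. 0 < emeasure M A \<longrightarrow>
      (\<exists>B\<in>sets M. B \<subseteq> A \<and> 0 < emeasure M B \<and> emeasure M B < emeasure M A))"

(* Isabelle's Bochner integral is 0 where the integrand is not integrable.  The inner integrals
   below are therefore total functions; in the complete spaces L and P their values on the null
   sets where h is not sectionwise integrable affect neither integrability nor the integrals. *)
definition fubini_extension ::
  "'i measure \<Rightarrow> 'w measure \<Rightarrow> ('i \<times> 'w) measure \<Rightarrow> bool" where
  "fubini_extension L P Q \<longleftrightarrow>
    prob_space Q \<and> complete_measure Q \<and>
    space Q = space L \<times> space P \<and>
    sets (L \<Otimes>\<^sub>M P) \<subseteq> sets Q \<and>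
    (\<forall>A\<in>sets (L \<Otimes>\<^sub>M P). emeasure Q A = emeasure (L \<Otimes>\<^sub>M P) A) \<and>
    (\<forall>h :: 'i \<times> 'w \<Rightarrow> real. integrable Q h \<longrightarrow>
      (AE i in L. integrable P (\<lambda>w. h (i, w))) \<and>
      (AE w in P. integrable L (\<lambda>i. h (i, w))) \<and>
      integrable L (\<lambda>i. \<integral>w. h (i, w) \<partial>P) \<and>
      integrable P (\<lambda>w. \<integral>i. h (i, w) \<partial>L) \<and>
      (\<integral>z. h z \<partial>Q) = (\<integral>i. (\<integral>w. h (i, w) \<partial>P) \<partial>L) \<and>
      (\<integral>z. h z \<partial>Q) = (\<integral>w. (\<integral>i. h (i, w) \<partial>L) \<partial>P))"

(* A sub-sigma-algebra is represented by a measure C of which only the space and the sets matter,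
   as in subalgebra and real_cond_exp. *)
definition full_subalgebra :: "'w measure \<Rightarrow> 'w measure \<Rightarrow> bool" where
  "full_subalgebra P C \<longleftrightarrow> subalgebra P C \<and> null_sets P \<subseteq> sets C"

definition countably_generated_mod_null :: "'w measure \<Rightarrow> 'w measure \<Rightarrow> bool" where
  "countably_generated_mod_null P C \<longleftrightarrow>
    (\<exists>E. countable E \<and> E \<subseteq> sets P \<and> sets C = sigma_sets (space P) (E \<union> null_sets P))"

definition cond_prob_given :: "'w measure \<Rightarrow> 'w measure \<Rightarrow> 'w set \<Rightarrow> 'w \<Rightarrow> real" where
  "cond_prob_given P C A = real_cond_exp P C (indicator A)"

(* Measurability is part of the definition: sections of a process are random variables only for
   almost every index. *)
definition cond_indep_given ::
  "'w measure \<Rightarrow> 'w measure \<Rightarrow> ('w \<Rightarrow> 'x::polish_space) \<Rightarrow> ('w \<Rightarrow> 'x) \<Rightarrow> bool" where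
  "cond_indep_given P C \<phi> \<psi> \<longleftrightarrow>
    \<phi> \<in> P \<rightarrow>\<^sub>M borel \<and> \<psi> \<in> P \<rightarrow>\<^sub>M borel \<and>
    (\<forall>B1\<in>sets borel. \<forall>B2\<in>sets borel.
      AE w in P. cond_prob_given P C ((\<phi> -` B1 \<inter> space P) \<inter> (\<psi> -` B2 \<inter> space P)) w =
        cond_prob_given P C (\<phi> -` B1 \<inter> space P) w * cond_prob_given P C (\<psi> -` B2 \<inter> space P) w)"

definition ess_pairwise_cond_indep ::
  "'i measure \<Rightarrow> 'w measure \<Rightarrow> 'w measure \<Rightarrow> ('i \<times> 'w \<Rightarrow> 'x::polish_space) \<Rightarrow> bool" where
  "ess_pairwise_cond_indep L P C f \<longleftrightarrow>
    (AE i1 in L. AE i2 in L. cond_indep_given P C (\<lambda>w. f (i1, w)) (\<lambda>w. f (i2, w)))"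

definition regular_cond_distr ::
  "'a measure \<Rightarrow> 'a measure \<Rightarrow> ('a \<Rightarrow> 'x::polish_space) \<Rightarrow> ('a \<Rightarrow> 'x measure) \<Rightarrow> bool" where
  "regular_cond_distr M G f \<mu> \<longleftrightarrow>
    \<mu> \<in> G \<rightarrow>\<^sub>M prob_algebra borel \<and>
    (\<forall>B\<in>sets borel. AE z in M. measure (\<mu> z) B = cond_prob_given M G (f -` B \<inter> space M) z)"

(* All probability spaces being complete, the product sigma-algebra of the index space with C is
   the completed one.  A kernel measurable with respect to the uncompleted product is also
   measurable here. *)
definition product_subalgebra ::
  "'i measure \<Rightarrow> 'w measure \<Rightarrow> 'w measure \<Rightarrow> ('i \<times> 'w) measure" where
  "product_subalgebra L P C = completion (L \<Otimes>\<^sub>M restr_to_subalg P C)"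

(* Here \<mu> is meant to be a regular conditional distribution of f given
   product_subalgebra L P C. *)
definition no_coalitional_uncertainty ::
  "'i measure \<Rightarrow> 'w measure \<Rightarrow> ('i \<times> 'w \<Rightarrow> 'x::polish_space) \<Rightarrow> ('i \<times> 'w \<Rightarrow> 'x measure) \<Rightarrow> bool" where
  "no_coalitional_uncertainty L P f \<mu> \<longleftrightarrow>
    (\<forall>A\<in>sets L. AE w in P. \<forall>B\<in>sets borel.
      measure L {i \<in> A. f (i, w) \<in> B} = (LINT i:A|L. measure (\<mu> (i, w)) B))"

end

theory Submission
  imports Defs
begin

text \<open>Fix an index \<open>i1\<close>, a set \<open>D\<close> in \<open>C\<close> and a Borel set \<open>B1\<close>, and put
  \<open>E = D \<inter> {f i1 \<in> B1}\<close>. Integrating the no-uncertainty identity for a coalition \<open>A\<close> over \<open>E\<close>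
  and exchanging the integrals gives
  \<open>\<integral>i\<in>A. P (E \<inter> {f i \<in> B2}) = \<integral>i\<in>A. \<integral>w\<in>E. \<mu> (i, w) B2\<close>. As \<open>A\<close> is arbitrary, the integrands
  agree for almost every \<open>i\<close>. Since \<open>C\<close> and the Borel sets have countable intersection-stable
  generators, the exceptional set of indices can be chosen independently of \<open>D\<close>, \<open>B1\<close>, \<open>B2\<close>.
  The case \<open>B1 = UNIV\<close> says that \<open>\<mu> (i, \<cdot>) B2\<close> is the conditional probability of
  \<open>{f i \<in> B2}\<close> given \<open>C\<close>, and then the general case is conditional independence.\<close>

section \<open>Countable intersection-stable generators\<close>

text \<open>The finite intersections of members of \<open>E\<close> form such a family, since a
  countable set has only countably many finite subsets. The extra factor \<open>\<Omega>\<close>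
  gives the empty intersection the right value, which puts \<open>\<Omega>\<close> itself into
  \<open>G\<close>.\<close>

lemma countable_Int_stable_generator:
  assumes "countable E" "E \<subseteq> Pow \<Omega>"
  obtains G where "countable G" "Int_stable G" "G \<subseteq> Pow \<Omega>" "\<Omega> \<in> G" "E \<subseteq> G"
    "G \<subseteq> sigma_sets \<Omega> E"
proof
  define G where "G = (\<lambda>F. \<Omega> \<inter> \<Inter>F) ` {F. finite F \<and> F \<subseteq> E}"
  show "countable G"
    unfolding G_def by (intro countable_image countable_Collect_finite_subset assms)
  have "(\<Omega> \<inter> \<Inter>F) \<inter> (\<Omega> \<inter> \<Inter>F') = \<Omega> \<inter> \<Inter>(F \<union> F')" for F F' :: "'a set set"
    by auto
  then show "Int_stable G"
    unfolding G_def by (intro Int_stableI_image) (metis (no_types, lifting) Un_least finite_Un mem_Collect_eq)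
  show "G \<subseteq> Pow \<Omega>"
    unfolding G_def by auto
  show "\<Omega> \<in> G"
    unfolding G_def by (auto intro!: image_eqI[of _ _ "{}"])
  show "E \<subseteq> G"
  proof
    fix A assume "A \<in> E"
    then show "A \<in> G"
      unfolding G_def using assms(2) by (intro image_eqI[of _ _ "{A}"]) auto
  qed
  interpret sigma_algebra \<Omega> "sigma_sets \<Omega> E"
    using assms(2) by (rule sigma_algebra_sigma_sets)
  have "\<Omega> \<inter> \<Inter>F \<in> sigma_sets \<Omega> E" if "finite F" "F \<subseteq> E" for F
    using that
  proof (induction F)
    case (insert A F)
    then have "A \<inter> (\<Omega> \<inter> \<Inter>F) \<in> sigma_sets \<Omega> E"
      by (intro Int sigma_sets.Basic insert.IH) auto
    moreover have "A \<inter> (\<Omega> \<inter> \<Inter>F) = \<Omega> \<inter> \<Inter>(insert A F)"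
      by auto
    ultimately show ?case
      by simp
  qed auto
  then show "G \<subseteq> sigma_sets \<Omega> E"
    unfolding G_def by auto
qed

lemma borel_countable_Int_stable_generator:
  obtains G :: "'x::second_countable_topology set set"
  where "countable G" "Int_stable G" "UNIV \<in> G" "sets borel = sigma_sets UNIV G"
proof -
  obtain E :: "'x set set" where E: "countable E" "topological_basis E"
    using ex_countable_basis by blast
  then have borel: "sets borel = sigma_sets UNIV E"
    by (simp add: borel_eq_countable_basis)
  obtain G where G: "countable G" "Int_stable G" "UNIV \<in> G" "E \<subseteq> G" "G \<subseteq> sigma_sets UNIV E"
    using countable_Int_stable_generator[of E UNIV] E by auto
  then have "sigma_sets UNIV E = sigma_sets UNIV G"
    by (intro sigma_sets_eqI) auto
  with G borel show thesis
    by (intro that) auto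
qed

section \<open>Integrals weighted by a probability kernel\<close>

lemma prob_algebra_kernelD:
  assumes "K \<in> M \<rightarrow>\<^sub>M prob_algebra N"
  shows "x \<in> space M \<Longrightarrow> prob_space (K x)"
    and "x \<in> space M \<Longrightarrow> sets (K x) = sets N"
    and "B \<in> sets N \<Longrightarrow> (\<lambda>x. measure (K x) B) \<in> borel_measurable M"
  using measurable_space[OF assms]
    measurable_compose[OF measurable_prob_algebraD[OF assms] measurable_measure_subprob_algebra]
  by (auto simp: space_prob_algebra)

lemma integrable_mult_kernel:
  fixes u :: "'a \<Rightarrow> real"
  assumes "integrable M u" "K \<in> M \<rightarrow>\<^sub>M prob_algebra N" "B \<in> sets N"
  shows "integrable M (\<lambda>x. u x * measure (K x) B)"
proof (rule Bochner_Integration.integrable_bound[OF assms(1)])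
  show "(\<lambda>x. u x * measure (K x) B) \<in> borel_measurable M"
    using assms prob_algebra_kernelD(3)[OF assms(2)] by measurable
  show "AE x in M. norm (u x * measure (K x) B) \<le> norm (u x)"
    using prob_space.prob_le_1[OF prob_algebra_kernelD(1)[OF assms(2)]]
    by (intro AE_I2) (auto simp: abs_mult intro!: mult_left_le)
qed

text \<open>Dominated convergence applies: by disjointness the partial sums of the masses are at
  most 1, so \<open>norm (u x)\<close> bounds all the integrands.\<close>

lemma integral_mult_kernel_sums:
  fixes u :: "'a \<Rightarrow> real"
  assumes u: "integrable M u" and K: "K \<in> M \<rightarrow>\<^sub>M prob_algebra N"
    and A: "disjoint_family A" "range A \<subseteq> sets N"
  shows "(\<lambda>k. \<integral>x. u x * measure (K x) (A k) \<partial>M) sums (\<integral>x. u x * measure (K x) (\<Union>k. A k) \<partial>M)"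
proof -
  have [measurable]: "u \<in> borel_measurable M"
    using u by auto
  have [measurable]: "(\<lambda>x. measure (K x) (A k)) \<in> borel_measurable M"
      "(\<lambda>x. measure (K x) (\<Union>k. A k)) \<in> borel_measurable M" for k
    using A by (auto intro!: prob_algebra_kernelD(3)[OF K])
  have sums: "(\<lambda>k. measure (K x) (A k)) sums measure (K x) (\<Union>k. A k)" if "x \<in> space M" for x
  proof -
    interpret prob_space "K x"
      by (rule prob_algebra_kernelD(1)[OF K that])
    show ?thesis
      using A prob_algebra_kernelD(2)[OF K that] by (intro finite_measure_UNION) auto
  qed
  have bound: "(\<Sum>k<n. measure (K x) (A k)) \<le> 1" if "x \<in> space M" for x n
  proof -
    interpret prob_space "K x"
      by (rule prob_algebra_kernelD(1)[OF K that])
    have "(\<Sum>k<n. measure (K x) (A k)) \<le> measure (K x) (\<Union>k. A k)"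
      using sums[OF that] by (intro sum_le_suminf[of "\<lambda>k. measure (K x) (A k)", simplified sums_unique[OF sums[OF that], symmetric]])
        (auto simp: sums_iff)
    then show ?thesis
      using prob_le_1[of "\<Union>k. A k"] by linarith
  qed
  have "(\<lambda>n. \<integral>x. u x * (\<Sum>k<n. measure (K x) (A k)) \<partial>M)
      \<longlonglongrightarrow> (\<integral>x. u x * measure (K x) (\<Union>k. A k) \<partial>M)"
  proof (rule integral_dominated_convergence[where w = "\<lambda>x. norm (u x)"])
    show "AE x in M. (\<lambda>n. u x * (\<Sum>k<n. measure (K x) (A k))) \<longlonglongrightarrow> u x * measure (K x) (\<Union>k. A k)"
      using sums by (intro AE_I2 tendsto_mult_left) (auto simp: sums_def)
    show "AE x in M. norm (u x * (\<Sum>k<n. measure (K x) (A k))) \<le> norm (u x)" for n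
      using bound by (intro AE_I2) (auto simp: abs_mult sum_nonneg intro!: mult_left_le)
  qed (use u in auto)
  moreover have "(\<integral>x. u x * (\<Sum>k<n. measure (K x) (A k)) \<partial>M)
      = (\<Sum>k<n. \<integral>x. u x * measure (K x) (A k) \<partial>M)" for n
    unfolding sum_distrib_left using A
    by (intro Bochner_Integration.integral_sum integrable_mult_kernel[OF u K]) auto
  ultimately show ?thesis
    by (simp add: sums_def)
qed

text \<open>As functions of \<open>B\<close> both sides are finite signed measures, so Dynkin's
  argument extends their equality from an intersection-stable generator. Having
  \<open>space N\<close> in \<open>G\<close> provides equal total masses, from which complements are
  treated by subtraction. Two weights and two kernels are allowed because later one side carries a
  point mass and the other a conditional distribution.\<close>

lemma integral_mult_kernel_eqI:
  fixes u v :: "'a \<Rightarrow> real"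
  assumes u: "integrable M u" and v: "integrable M v"
    and K: "K \<in> M \<rightarrow>\<^sub>M prob_algebra N" and K': "K' \<in> M \<rightarrow>\<^sub>M prob_algebra N"
    and gen: "sets N = sigma_sets (space N) G" "Int_stable G" "G \<subseteq> Pow (space N)" "space N \<in> G"
    and eq: "\<And>B. B \<in> G \<Longrightarrow> (\<integral>x. u x * measure (K x) B \<partial>M) = (\<integral>x. v x * measure (K' x) B \<partial>M)"
    and B: "B \<in> sets N"
  shows "(\<integral>x. u x * measure (K x) B \<partial>M) = (\<integral>x. v x * measure (K' x) B \<partial>M)"
  using gen(2,3) B[unfolded gen(1)]
proof (induction rule: sigma_sets_induct_disjoint)
  case (compl B)
  then have B: "B \<in> sets N"
    using gen by simp
  have compl_eq: "(\<integral>x. w x * measure (H x) (space N - B) \<partial>M)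
      = (\<integral>x. w x * measure (H x) (space N) \<partial>M) - (\<integral>x. w x * measure (H x) B \<partial>M)"
    if w: "integrable M w" and H: "H \<in> M \<rightarrow>\<^sub>M prob_algebra N" for w :: "'a \<Rightarrow> real" and H
  proof -
    have "measure (H x) (space N - B) = measure (H x) (space N) - measure (H x) B" if "x \<in> space M" for x
    proof -
      interpret prob_space "H x"
        by (rule prob_algebra_kernelD(1)[OF H that])
      show ?thesis
        using B sets.sets_into_space[OF B] prob_algebra_kernelD(2)[OF H that]
        by (intro finite_measure_Diff) auto
    qed
    then have "(\<integral>x. w x * measure (H x) (space N - B) \<partial>M)
        = (\<integral>x. w x * measure (H x) (space N) - w x * measure (H x) B \<partial>M)"
      by (intro Bochner_Integration.integral_cong) (auto simp: right_diff_distrib)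
    then show ?thesis
      using B by (simp add: integrable_mult_kernel[OF w H])
  qed
  show ?case
    unfolding compl_eq[OF u K] compl_eq[OF v K'] using compl.IH eq[OF gen(4)] by simp
next
  case (union A)
  then have "range A \<subseteq> sets N"
    using gen by simp
  then have "(\<lambda>k. \<integral>x. u x * measure (K x) (A k) \<partial>M) sums (\<integral>x. u x * measure (K x) (\<Union>k. A k) \<partial>M)"
    and "(\<lambda>k. \<integral>x. v x * measure (K' x) (A k) \<partial>M) sums (\<integral>x. v x * measure (K' x) (\<Union>k. A k) \<partial>M)"
    using union.hyps by (auto intro!: integral_mult_kernel_sums u v K K')
  then show ?case
    unfolding union.IH by (rule sums_unique2)
qed (auto simp: eq)

section \<open>Completeness and the product sigma-algebra\<close>

lemma (in complete_measure) borel_measurable_cong_AE: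
  fixes u v :: "'a \<Rightarrow> 'b::topological_space"
  assumes v: "v \<in> borel_measurable M" and eq: "AE x in M. u x = v x"
  shows "u \<in> borel_measurable M"
proof (rule measurableI)
  fix S :: "'b set" assume S: "S \<in> sets borel"
  show "u -` S \<inter> space M \<in> sets M"
  proof (rule in_sets_AE)
    show "v -` S \<inter> space M \<in> sets M"
      using v S by (rule measurable_sets)
    show "AE x in M. x \<in> v -` S \<inter> space M \<longleftrightarrow> x \<in> u -` S \<inter> space M"
      using eq by eventually_elim auto
  qed auto
qed auto

text \<open>A subset of a null set of the restriction is a null set of \<open>P\<close>, by
  completeness of \<open>P\<close>, and \<open>C\<close> contains all of these.\<close>

lemma complete_measure_restr_to_subalg:
  assumes "complete_measure P" "full_subalgebra P C"
  shows "complete_measure (restr_to_subalg P C)"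
proof
  interpret complete_measure P by fact
  have sub: "subalgebra P C" and null: "null_sets P \<subseteq> sets C"
    using assms(2) by (auto simp: full_subalgebra_def)
  fix A B assume "B \<subseteq> A" "A \<in> null_sets (restr_to_subalg P C)"
  then have "B \<in> null_sets P"
    using complete2[of B A] by (auto simp: null_sets_restr_to_subalg[OF sub])
  then show "B \<in> sets (restr_to_subalg P C)"
    using null by (auto simp: sets_restr_to_subalg[OF sub])
qed

text \<open>On the completed product \<open>g\<close> is only almost everywhere equal to a function
  \<open>h\<close> measurable for the plain product. For almost every \<open>i\<close> the sections
  of \<open>g\<close> and \<open>h\<close> then agree almost everywhere, and completeness of the
  restriction of \<open>P\<close> to \<open>C\<close> carries measurability over from
  \<open>h\<close> to \<open>g\<close>.\<close>

lemma AE_section_measurable_product_subalgebra: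
  fixes g :: "'i \<times> 'w \<Rightarrow> real"
  assumes "prob_space L" "prob_space P" "complete_measure P" "full_subalgebra P C"
    and g: "g \<in> borel_measurable (product_subalgebra L P C)"
  shows "AE i in L. (\<lambda>w. g (i, w)) \<in> borel_measurable C"
proof -
  let ?R = "restr_to_subalg P C"
  have sub: "subalgebra P C"
    using assms(4) by (auto simp: full_subalgebra_def)
  interpret L: prob_space L by fact
  interpret R: prob_space ?R
    using sub assms(2) by (rule prob_space_restr_to_subalg)
  interpret R: complete_measure ?R
    using assms by (intro complete_measure_restr_to_subalg)
  interpret LR: pair_sigma_finite L ?R ..
  obtain h where [measurable]: "h \<in> borel_measurable (L \<Otimes>\<^sub>M ?R)"
    and "AE z in L \<Otimes>\<^sub>M ?R. g z = h z"
    using completion_ex_borel_measurable_real g unfolding product_subalgebra_def by blast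
  then have "AE i in L. AE w in ?R. g (i, w) = h (i, w)"
    by (intro LR.AE_pair)
  then show ?thesis
    using AE_space
  proof eventually_elim
    case (elim i)
    have "(\<lambda>w. h (i, w)) \<in> borel_measurable ?R"
      using elim(2) by measurable
    then have "(\<lambda>w. g (i, w)) \<in> borel_measurable ?R"
      using elim(1) by (rule R.borel_measurable_cong_AE)
    then show ?case
      by (rule measurable_in_subalg'[OF sub])
  qed
qed

text \<open>\<open>Q\<close> contains the plain product, and it absorbs the subsets of null sets
  added by the completion because it is complete and extends the product measure. This is what makes
  a kernel for the product subalgebra measurable on \<open>Q\<close>.\<close>

lemma sets_product_subalgebra_subset:
  assumes "prob_space L" "prob_space P" "subalgebra P C"
    and Q: "fubini_extension L P Q"
  shows "space (product_subalgebra L P C) = space Q"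
    and "sets (product_subalgebra L P C) \<subseteq> sets Q"
proof -
  let ?R = "restr_to_subalg P C"
  interpret P: prob_space P by fact
  interpret R: prob_space ?R
    by (rule prob_space_restr_to_subalg) fact+
  have spQ: "space Q = space L \<times> space P" and setsQ: "sets (L \<Otimes>\<^sub>M P) \<subseteq> sets Q"
    and emQ: "\<And>A. A \<in> sets (L \<Otimes>\<^sub>M P) \<Longrightarrow> emeasure Q A = emeasure (L \<Otimes>\<^sub>M P) A"
    and "complete_measure Q"
    using Q by (auto simp: fubini_extension_def)
  interpret Q: complete_measure Q by fact
  show "space (product_subalgebra L P C) = space Q"
    by (simp add: product_subalgebra_def spQ space_pair_measure space_restr_to_subalg)
  \<comment> \<open>The inclusion of product sigma-algebras is read off from the measurability of
    the identity map, taken componentwise.\<close>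
  have id: "(\<lambda>x. x) \<in> P \<rightarrow>\<^sub>M ?R"
    by (intro measurable_from_subalg[OF assms(3)] measurable_ident_sets)
      (simp add: sets_restr_to_subalg[OF assms(3)])
  have "(\<lambda>z. (fst z, snd z)) \<in> L \<Otimes>\<^sub>M P \<rightarrow>\<^sub>M L \<Otimes>\<^sub>M ?R"
    by (intro measurable_Pair measurable_fst measurable_compose[OF measurable_snd id])
  then have pair: "sets (L \<Otimes>\<^sub>M ?R) \<subseteq> sets (L \<Otimes>\<^sub>M P)"
  proof (intro subsetI)
    fix A assume id2: "(\<lambda>z. (fst z, snd z)) \<in> L \<Otimes>\<^sub>M P \<rightarrow>\<^sub>M L \<Otimes>\<^sub>M ?R" and A: "A \<in> sets (L \<Otimes>\<^sub>M ?R)"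
    have "A \<subseteq> space (L \<Otimes>\<^sub>M P)"
      using sets.sets_into_space[OF A] by (simp add: space_pair_measure space_restr_to_subalg)
    then have "(\<lambda>z. (fst z, snd z)) -` A \<inter> space (L \<Otimes>\<^sub>M P) = A"
      by auto
    with measurable_sets[OF id2 A] show "A \<in> sets (L \<Otimes>\<^sub>M P)"
      by simp
  qed
  have null: "A \<in> null_sets Q" if "A \<in> null_sets (L \<Otimes>\<^sub>M ?R)" for A
  proof -
    have A: "A \<in> sets (L \<Otimes>\<^sub>M ?R)" and A': "A \<in> sets (L \<Otimes>\<^sub>M P)"
      using that pair by auto
    \<comment> \<open>Both product measures integrate the measures of the sections, and these agree
      because the sections of \<open>A\<close> lie in \<open>C\<close>.\<close>
    have "emeasure (L \<Otimes>\<^sub>M P) A = (\<integral>\<^sup>+ i. emeasure P (Pair i -` A) \<partial>L)"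
      by (rule P.emeasure_pair_measure_alt[OF A'])
    also have "\<dots> = (\<integral>\<^sup>+ i. emeasure ?R (Pair i -` A) \<partial>L)"
      using sets_Pair1[OF A] assms(3)
      by (intro nn_integral_cong emeasure_restr_to_subalg[symmetric]) (auto simp: sets_restr_to_subalg)
    also have "\<dots> = emeasure (L \<Otimes>\<^sub>M ?R) A"
      by (rule R.emeasure_pair_measure_alt[OF A, symmetric])
    finally show ?thesis
      using that A' emQ[OF A'] setsQ by (intro null_setsI) auto
  qed
  show "sets (product_subalgebra L P C) \<subseteq> sets Q"
  proof
    fix A assume "A \<in> sets (product_subalgebra L P C)"
    then obtain S N N' where A: "A = S \<union> N" "S \<in> sets (L \<Otimes>\<^sub>M ?R)" "N' \<in> null_sets (L \<Otimes>\<^sub>M ?R)" "N \<subseteq> N'"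
      unfolding product_subalgebra_def by (elim sets_completionE) auto
    moreover have "N \<in> sets Q"
      using Q.complete A null by blast
    ultimately show "A \<in> sets Q"
      using pair setsQ by auto
  qed
qed

section \<open>Integral identities extended from generators\<close>

text \<open>The factor \<open>indicator B (X x)\<close> is the mass that the point measure at
  \<open>X x\<close> gives to \<open>B\<close>, so this is the kernel version for the kernel
  \<open>return N (X x)\<close>.\<close>

lemma integral_mult_indicator_eqI:
  fixes u v :: "'a \<Rightarrow> real"
  assumes u: "integrable M u" and v: "integrable M v" and X: "X \<in> M \<rightarrow>\<^sub>M N"
    and gen: "sets N = sigma_sets (space N) G" "Int_stable G" "G \<subseteq> Pow (space N)" "space N \<in> G"
    and eq: "\<And>B. B \<in> G \<Longrightarrow> (\<integral>x. u x * indicator B (X x) \<partial>M) = (\<integral>x. v x * indicator B (X x) \<partial>M)"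
    and B: "B \<in> sets N"
  shows "(\<integral>x. u x * indicator B (X x) \<partial>M) = (\<integral>x. v x * indicator B (X x) \<partial>M)"
proof -
  have K: "(\<lambda>x. return N (X x)) \<in> M \<rightarrow>\<^sub>M prob_algebra N"
    by (rule measurable_compose[OF X measurable_return_prob_space])
  have "G \<subseteq> sets N"
    by (auto simp: gen(1))
  then have "(\<integral>x. u x * measure (return N (X x)) B' \<partial>M) = (\<integral>x. v x * measure (return N (X x)) B' \<partial>M)"
    if "B' \<in> G" for B'
    using eq that by (auto simp: measure_return)
  from integral_mult_kernel_eqI[OF u v K K gen this B] show ?thesis
    using B by (simp add: measure_return)
qed

text \<open>The three sets are released from their generators one after the other: first
  \<open>D\<close>, then \<open>B1\<close>, then \<open>B2\<close>. At each stage the factors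
  belonging to the other two sets serve as the integrable weight, or as part of it, and the previous
  stage supplies the identity on the generator.\<close>

lemma set_integral_kernel_eqI:
  fixes \<phi> \<psi> :: "'w \<Rightarrow> 'x::second_countable_topology"
  assumes "prob_space P" and sub: "subalgebra P C"
    and [measurable]: "\<phi> \<in> P \<rightarrow>\<^sub>M borel" "\<psi> \<in> P \<rightarrow>\<^sub>M borel" and K: "K \<in> P \<rightarrow>\<^sub>M prob_algebra borel"
    and G: "sets C = sigma_sets (space C) G" "Int_stable G" "G \<subseteq> Pow (space C)" "space C \<in> G"
    and H: "sets (borel :: 'x measure) = sigma_sets UNIV H" "Int_stable H" "UNIV \<in> H"
    and eq: "\<And>D B1 B2. D \<in> G \<Longrightarrow> B1 \<in> H \<Longrightarrow> B2 \<in> H \<Longrightarrow>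
      (LINT w:D|P. indicator B1 (\<phi> w) * indicator B2 (\<psi> w)) =
      (LINT w:D|P. indicator B1 (\<phi> w) * measure (K w) B2)"
    and D: "D \<in> sets C" and B1: "B1 \<in> sets borel" and B2: "B2 \<in> sets borel"
  shows "(LINT w:D|P. indicator B1 (\<phi> w) * indicator B2 (\<psi> w)) =
    (LINT w:D|P. indicator B1 (\<phi> w) * measure (K w) B2)"
proof -
  interpret prob_space P by fact
  have HB: "B \<in> sets borel" if "B \<in> H" for B
    using that by (simp add: H(1))
  have ind: "integrable P (\<lambda>w. indicator B (X w) :: real)"
    if "B \<in> sets N" "X \<in> P \<rightarrow>\<^sub>M N" for B X and N :: "'y measure"
    using that by (intro integrable_const_bound[of _ 1]) auto
  have mult_ind: "integrable P (\<lambda>w. u w * indicator B (X w))"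
    if "integrable P u" "B \<in> sets N" "X \<in> P \<rightarrow>\<^sub>M N" for u :: "'w \<Rightarrow> real" and B X and N :: "'y measure"
    using that by (intro Bochner_Integration.integrable_bound[OF that(1)]) (auto split: split_indicator)
  \<comment> \<open>With the identity as random variable from \<open>P\<close> to \<open>C\<close>,
    the indicator of \<open>D\<close> takes the form treated by
    \<open>integral_mult_indicator_eqI\<close>.\<close>
  have id: "(\<lambda>w. w) \<in> P \<rightarrow>\<^sub>M C"
    by (intro measurable_from_subalg[OF sub] measurable_ident_sets refl)
  have H': "sets (borel :: 'x measure) = sigma_sets (space borel) H" "Int_stable H"
    "H \<subseteq> Pow (space borel)" "space borel \<in> H"
    using H by auto
  have ind1: "integrable P (\<lambda>w. indicator B (\<phi> w) :: real)" if "B \<in> sets borel" for B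
    using that by (intro ind) auto
  have 1: "(\<integral>w. indicator B1 (\<phi> w) * indicator B2 (\<psi> w) * indicator D w \<partial>P) =
      (\<integral>w. indicator B1 (\<phi> w) * measure (K w) B2 * indicator D w \<partial>P)"
    if "D \<in> sets C" "B1 \<in> H" "B2 \<in> H" for D B1 B2
  proof (rule integral_mult_indicator_eqI[OF _ _ id G _ that(1)])
    show "integrable P (\<lambda>w. indicator B1 (\<phi> w) * indicator B2 (\<psi> w) :: real)"
      using HB that by (intro mult_ind[of _ _ borel] ind1) auto
    show "integrable P (\<lambda>w. indicator B1 (\<phi> w) * measure (K w) B2)"
      using HB that by (intro integrable_mult_kernel[OF _ K] ind1) auto
  qed (use eq that in \<open>auto simp: set_lebesgue_integral_def mult_ac\<close>)
  have 2: "(\<integral>w. indicator D w * indicator B2 (\<psi> w) * indicator B1 (\<phi> w) \<partial>P) =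
      (\<integral>w. indicator D w * measure (K w) B2 * indicator B1 (\<phi> w) \<partial>P)"
    if "D \<in> sets C" "B1 \<in> sets borel" "B2 \<in> H" for D B1 B2
  proof (rule integral_mult_indicator_eqI[OF _ _ _ H' _ that(2)])
    have D: "integrable P (\<lambda>w. indicator D w :: real)"
      using that id by (intro ind) auto
    show "integrable P (\<lambda>w. indicator D w * indicator B2 (\<psi> w) :: real)"
      using HB that by (intro mult_ind[of _ _ borel] D) auto
    show "integrable P (\<lambda>w. indicator D w * measure (K w) B2)"
      using HB that by (intro integrable_mult_kernel[OF _ K] D) auto
  qed (use 1 that in \<open>auto simp: mult_ac\<close>)
  \<comment> \<open>Here the weights coincide and the kernels differ: the point mass at
    \<open>\<psi> w\<close> stands on the left and \<open>K w\<close> on the right.\<close>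
  have 3: "(\<integral>w. indicator D w * indicator B1 (\<phi> w) * measure (return borel (\<psi> w)) B2 \<partial>P) =
      (\<integral>w. indicator D w * indicator B1 (\<phi> w) * measure (K w) B2 \<partial>P)"
  proof (rule integral_mult_kernel_eqI[OF _ _ _ K H' _ B2])
    show "(\<lambda>w. return borel (\<psi> w)) \<in> P \<rightarrow>\<^sub>M prob_algebra borel"
      by (rule measurable_compose[OF _ measurable_return_prob_space]) measurable
    have "integrable P (\<lambda>w. indicator D w :: real)"
      using D id by (intro ind) auto
    then show "integrable P (\<lambda>w. indicator D w * indicator B1 (\<phi> w) :: real)"
      "integrable P (\<lambda>w. indicator D w * indicator B1 (\<phi> w) :: real)"
      using B1 by (auto intro!: mult_ind[of _ _ borel])
    show "(\<integral>w. indicator D w * indicator B1 (\<phi> w) * measure (return borel (\<psi> w)) B \<partial>P) =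
        (\<integral>w. indicator D w * indicator B1 (\<phi> w) * measure (K w) B \<partial>P)" if "B \<in> H" for B
      using 2[OF D B1 that] HB[OF that] by (simp add: measure_return mult_ac)
  qed
  then show ?thesis
    using B2 by (simp add: measure_return set_lebesgue_integral_def mult_ac)
qed

section \<open>Conditional independence from a kernel\<close>

text \<open>Because \<open>K\<close> is measurable for \<open>C\<close>, the hypothesis identifies
  \<open>measure (K w) B2\<close> as the conditional probability of \<open>I2\<close>. It also
  identifies the conditional probability of \<open>I1 \<inter> I2\<close> as \<open>c1\<close> times
  the same function, and comparing the two gives the product formula.\<close>

lemma cond_indep_given_kernelI:
  assumes "prob_space P" and sub: "subalgebra P C"
    and \<phi>[measurable]: "\<phi> \<in> P \<rightarrow>\<^sub>M borel" and \<psi>[measurable]: "\<psi> \<in> P \<rightarrow>\<^sub>M borel"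
    and K: "K \<in> C \<rightarrow>\<^sub>M prob_algebra borel"
    and eq: "\<And>D B1 B2. D \<in> sets C \<Longrightarrow> B1 \<in> sets borel \<Longrightarrow> B2 \<in> sets borel \<Longrightarrow>
      (LINT w:D|P. indicator B1 (\<phi> w) * indicator B2 (\<psi> w)) =
      (LINT w:D|P. indicator B1 (\<phi> w) * measure (K w) B2)"
  shows "cond_indep_given P C \<phi> \<psi>"
  unfolding cond_indep_given_def
proof (intro conjI \<phi> \<psi> ballI)
  fix B1 B2 :: "'b set" assume B1[measurable]: "B1 \<in> sets borel" and B2[measurable]: "B2 \<in> sets borel"
  interpret prob_space P by fact
  interpret finite_measure_subalgebra P C
    using sub by unfold_locales
  define I1 I2 where "I1 = \<phi> -` B1 \<inter> space P" and "I2 = \<psi> -` B2 \<inter> space P"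
  have [measurable]: "I1 \<in> sets P" "I2 \<in> sets P"
    by (auto simp: I1_def I2_def)
  have ind: "integrable P (indicator I :: _ \<Rightarrow> real)" if "I \<in> sets P" for I
    using that by (intro integrable_real_indicator) (auto simp: emeasure_eq_measure)
  define c1 where "c1 = cond_prob_given P C I1"
  have [measurable]: "c1 \<in> borel_measurable C"
    by (simp add: c1_def cond_prob_given_def)
  have KP: "K \<in> P \<rightarrow>\<^sub>M prob_algebra borel"
    using sub K by (rule measurable_from_subalg)
  have KC[measurable]: "(\<lambda>w. measure (K w) B2) \<in> borel_measurable C"
    using K B2 by (rule prob_algebra_kernelD(3))
  have DP: "D \<in> sets P" if "D \<in> sets C" for D
    using that sub by (auto simp: subalgebra_def)
  have "AE w in P. cond_prob_given P C I2 w = measure (K w) B2"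
    unfolding cond_prob_given_def
  proof (rule real_cond_exp_charact)
    fix D assume D: "D \<in> sets C"
    \<comment> \<open>The choice of \<open>UNIV\<close> for the first Borel set removes \<phi> from
      the identity.\<close>
    have "(LINT w:D|P. indicator I2 w :: real) = (LINT w:D|P. indicator UNIV (\<phi> w) * indicator B2 (\<psi> w))"
      unfolding set_lebesgue_integral_def
      by (intro Bochner_Integration.integral_cong) (auto simp: I2_def split: split_indicator)
    also have "\<dots> = (LINT w:D|P. measure (K w) B2)"
      by (subst eq[OF D]) auto
    finally show "(LINT w:D|P. indicator I2 w :: real) = (LINT w:D|P. measure (K w) B2)" .
  next
    show "integrable P (\<lambda>w. measure (K w) B2)"
      using integrable_mult_kernel[OF _ KP B2, of "\<lambda>_. 1"] by simp
  qed (auto intro!: ind)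
  moreover have "AE w in P. cond_prob_given P C (I1 \<inter> I2) w = c1 w * measure (K w) B2"
    unfolding cond_prob_given_def
  proof (rule real_cond_exp_charact)
    have I1: "integrable P (indicator I1 :: 'a \<Rightarrow> real)"
      by (auto intro!: ind)
    fix D assume D[measurable]: "D \<in> sets C"
    have [measurable]: "D \<in> sets P"
      using D by (rule DP)
    have "(LINT w:D|P. indicator (I1 \<inter> I2) w :: real) = (LINT w:D|P. indicator B1 (\<phi> w) * indicator B2 (\<psi> w))"
      unfolding set_lebesgue_integral_def
      by (intro Bochner_Integration.integral_cong) (auto simp: I1_def I2_def split: split_indicator)
    also have "\<dots> = (LINT w:D|P. indicator B1 (\<phi> w) * measure (K w) B2)"
      using D B1 B2 by (rule eq)
    also have "\<dots> = (\<integral>w. (indicator D w * measure (K w) B2) * indicator I1 w \<partial>P)"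
      unfolding set_lebesgue_integral_def
      by (intro Bochner_Integration.integral_cong) (auto simp: I1_def split: split_indicator)
    \<comment> \<open>The weight \<open>indicator D w * measure (K w) B2\<close> is measurable for
      \<open>C\<close>, so the indicator of \<open>I1\<close> may be replaced by its conditional
      expectation under the integral.\<close>
    also have "\<dots> = (\<integral>w. (indicator D w * measure (K w) B2) * c1 w \<partial>P)"
      unfolding c1_def cond_prob_given_def
    proof (rule real_cond_exp_intg(2)[symmetric])
      show "integrable P (\<lambda>w. indicator D w * measure (K w) B2 * indicator I1 w)"
        using integrable_mult_indicator[OF \<open>D \<in> sets P\<close> integrable_mult_kernel[OF I1 KP B2]]
        by (simp add: mult_ac)
    qed measurable
    also have "\<dots> = (LINT w:D|P. c1 w * measure (K w) B2)"
      by (simp add: set_lebesgue_integral_def mult_ac)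
    finally show "(LINT w:D|P. indicator (I1 \<inter> I2) w :: real) = (LINT w:D|P. c1 w * measure (K w) B2)" .
  next
    have "integrable P c1"
      unfolding c1_def cond_prob_given_def
      by (intro real_cond_exp_int) (auto intro!: ind)
    then show "integrable P (\<lambda>w. c1 w * measure (K w) B2)"
      by (rule integrable_mult_kernel[OF _ KP B2])
    show "(\<lambda>w. c1 w * measure (K w) B2) \<in> borel_measurable C"
      by measurable
  qed (auto intro!: ind)
  ultimately have "AE w in P. cond_prob_given P C (I1 \<inter> I2) w = c1 w * cond_prob_given P C I2 w"
    by eventually_elim simp
  then show "AE w in P. cond_prob_given P C ((\<phi> -` B1 \<inter> space P) \<inter> (\<psi> -` B2 \<inter> space P)) w =
      cond_prob_given P C (\<phi> -` B1 \<inter> space P) w * cond_prob_given P C (\<psi> -` B2 \<inter> space P) w"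
    unfolding c1_def I1_def I2_def .
qed

section \<open>Sections in a Fubini extension\<close>

lemma fubini_extensionD:
  fixes h :: "'i \<times> 'w \<Rightarrow> real"
  assumes "fubini_extension L P Q" "integrable Q h"
  shows "AE i in L. integrable P (\<lambda>w. h (i, w))"
    and "AE w in P. integrable L (\<lambda>i. h (i, w))"
    and "integrable L (\<lambda>i. \<integral>w. h (i, w) \<partial>P)"
    and "integrable P (\<lambda>w. \<integral>i. h (i, w) \<partial>L)"
    and "(\<integral>i. (\<integral>w. h (i, w) \<partial>P) \<partial>L) = (\<integral>z. h z \<partial>Q)"
    and "(\<integral>w. (\<integral>i. h (i, w) \<partial>L) \<partial>P) = (\<integral>z. h z \<partial>Q)"
  using assms by (auto simp: fubini_extension_def)

text \<open>Integrating over \<open>A \<times> E\<close> in both orders turns the assumed identity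
  of integrals over \<open>A\<close> into equality of the integrals over \<open>A\<close> of the two
  functions of \<open>i\<close> in question. Since \<open>A\<close> is arbitrary, these agree almost
  everywhere. The null set in the assumption may depend on \<open>A\<close>, because
  \<open>w\<close> is integrated out while \<open>A\<close> is fixed.\<close>

lemma fubini_extension_AE_section_integral_eq:
  fixes g g' :: "'i \<times> 'w \<Rightarrow> real"
  assumes Q: "fubini_extension L P Q" and g: "integrable Q g" and g': "integrable Q g'"
    and eq: "\<And>A. A \<in> sets L \<Longrightarrow> AE w in P. (LINT i:A|L. g (i, w)) = (LINT i:A|L. g' (i, w))"
    and E: "E \<in> sets P"
  shows "AE i in L. (LINT w:E|P. g (i, w)) = (LINT w:E|P. g' (i, w))"
proof -
  have "A \<times> E \<in> sets Q" if "A \<in> sets L" for A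
    using Q that E by (auto simp: fubini_extension_def)
  then have int: "integrable Q (\<lambda>z. indicator (A \<times> E) z * h z)" if "A \<in> sets L" "integrable Q h" for A and h :: "_ \<Rightarrow> real"
    using integrable_mult_indicator[of "A \<times> E" Q h] that by simp
  have inner: "(\<integral>w. indicator (A \<times> E) (i, w) * h (i, w) \<partial>P) = indicator A i * (LINT w:E|P. h (i, w))" for A i and h :: "_ \<Rightarrow> real"
    by (simp add: set_lebesgue_integral_def indicator_times mult.assoc)
  have inner': "(\<integral>i. indicator (A \<times> E) (i, w) * h (i, w) \<partial>L) = indicator E w * (LINT i:A|L. h (i, w))" for A w and h :: "_ \<Rightarrow> real"
  proof -
    have "(\<integral>i. indicator (A \<times> E) (i, w) * h (i, w) \<partial>L) = (\<integral>i. indicator E w * (indicator A i * h (i, w)) \<partial>L)"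
      by (intro Bochner_Integration.integral_cong) (simp_all add: indicator_times)
    then show ?thesis
      by (simp add: set_lebesgue_integral_def)
  qed
  have outer: "integrable L (\<lambda>i. LINT w:E|P. h (i, w))" if "integrable Q h" for h :: "_ \<Rightarrow> real"
  proof -
    \<comment> \<open>The whole index space in the role of \<open>A\<close> reduces this to the
      Fubini property for the product of \<open>h\<close> with the indicator of a rectangle.\<close>
    have "integrable L (\<lambda>i. indicator (space L) i * (LINT w:E|P. h (i, w)))"
      using fubini_extensionD(3)[OF Q int[OF sets.top that]] unfolding inner .
    then show ?thesis
      by (rule Bochner_Integration.integrable_cong[THEN iffD1, rotated 2]) auto
  qed
  show ?thesis
  proof (rule density_unique_real[OF outer[OF g] outer[OF g']])
    fix A assume A: "A \<in> sets L"
    have "(LINT i:A|L. LINT w:E|P. g (i, w)) = (\<integral>z. indicator (A \<times> E) z * g z \<partial>Q)"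
      using fubini_extensionD(5)[OF Q int[OF A g]] unfolding inner by (simp add: set_lebesgue_integral_def)
    also have "\<dots> = (\<integral>w. indicator E w * (LINT i:A|L. g (i, w)) \<partial>P)"
      using fubini_extensionD(6)[OF Q int[OF A g]] unfolding inner' by simp
    also have "\<dots> = (\<integral>w. indicator E w * (LINT i:A|L. g' (i, w)) \<partial>P)"
      using fubini_extensionD(4)[OF Q int[OF A g]] fubini_extensionD(4)[OF Q int[OF A g']] eq[OF A]
      unfolding inner' by (intro integral_cong_AE) auto
    also have "\<dots> = (\<integral>z. indicator (A \<times> E) z * g' z \<partial>Q)"
      using fubini_extensionD(6)[OF Q int[OF A g']] unfolding inner' by simp
    also have "\<dots> = (LINT i:A|L. LINT w:E|P. g' (i, w))"
      using fubini_extensionD(5)[OF Q int[OF A g']] unfolding inner by (simp add: set_lebesgue_integral_def)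
    finally show "(LINT i:A|L. LINT w:E|P. g (i, w)) = (LINT i:A|L. LINT w:E|P. g' (i, w))" .
  qed
qed

text \<open>As \<open>Q\<close> may be strictly larger than the product, measurability of sections
  is available only for almost every \<open>i\<close> and only through the Fubini property. It is
  obtained for one Borel set at a time; a countable generator allows the exceptional null sets to be
  united.\<close>

lemma AE_section_measurable_process:
  fixes f :: "'i \<times> 'w \<Rightarrow> 'x::second_countable_topology"
  assumes Q: "fubini_extension L P Q" and f: "f \<in> Q \<rightarrow>\<^sub>M borel"
  shows "AE i in L. (\<lambda>w. f (i, w)) \<in> P \<rightarrow>\<^sub>M borel"
proof -
  obtain G :: "'x set set" where G: "countable G" "sets borel = sigma_sets UNIV G"
    using borel_countable_Int_stable_generator by metis
  interpret prob_space Q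
    using Q by (auto simp: fubini_extension_def)
  have spQ: "space Q = space L \<times> space P"
    using Q by (auto simp: fubini_extension_def)
  have "AE i in L. (\<lambda>w. f (i, w)) -` B \<inter> space P \<in> sets P" if "B \<in> G" for B
  proof -
    have "f -` B \<inter> space Q \<in> sets Q"
      using f that G(2) by (intro measurable_sets[OF f]) simp
    \<comment> \<open>Integrability is a vehicle for measurability: where the section of this
      indicator is integrable, the section of the set is measurable.\<close>
    then have "integrable Q (indicator (f -` B \<inter> space Q) :: _ \<Rightarrow> real)"
      by (intro integrable_real_indicator) (auto simp: less_top[symmetric])
    from fubini_extensionD(1)[OF Q this] show ?thesis
      using AE_space
    proof eventually_elim
      case (elim i)
      have "indicator (f -` B \<inter> space Q) (i, w) = (indicator ((\<lambda>w. f (i, w)) -` B \<inter> space P) w :: real)" for w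
        using elim(2) by (auto simp: spQ split: split_indicator)
      with elim(1) show ?case
        by (simp add: integrable_indicator_iff inf_assoc)
    qed
  qed
  then have "AE i in L. \<forall>B\<in>G. (\<lambda>w. f (i, w)) -` B \<inter> space P \<in> sets P"
    using G(1) by (simp add: AE_ball_countable)
  then show ?thesis
    by eventually_elim (rule measurable_sigma_sets[OF G(2)], auto)
qed

text \<open>Measurability of a kernel can be tested on its values at the sets of an
  intersection-stable generator. These values are real functions, whose sections are measurable for
  \<open>C\<close> for almost every \<open>i\<close>, and countably many of them suffice.\<close>

lemma AE_section_measurable_kernel:
  fixes \<mu> :: "'i \<times> 'w \<Rightarrow> 'x::second_countable_topology measure"
  assumes "prob_space L" "prob_space P" "complete_measure P" "full_subalgebra P C"
    and \<mu>: "\<mu> \<in> product_subalgebra L P C \<rightarrow>\<^sub>M prob_algebra borel"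
  shows "AE i in L. (\<lambda>w. \<mu> (i, w)) \<in> C \<rightarrow>\<^sub>M prob_algebra borel"
proof -
  obtain G :: "'x set set" where G: "countable G" "Int_stable G" "sets borel = sigma_sets UNIV G"
    using borel_countable_Int_stable_generator by metis
  have spC: "space C = space P"
    using assms(4) by (simp add: full_subalgebra_def subalgebra_def)
  have sp: "space (product_subalgebra L P C) = space L \<times> space P"
    by (simp add: product_subalgebra_def space_pair_measure space_restr_to_subalg)
  have "AE i in L. \<forall>B\<in>G. (\<lambda>w. measure (\<mu> (i, w)) B) \<in> borel_measurable C"
    using G by (auto simp: AE_ball_countable
        intro!: AE_section_measurable_product_subalgebra[OF assms(1-4)] prob_algebra_kernelD(3)[OF \<mu>])
  then show ?thesis
    using AE_space
  proof eventually_elim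
    case (elim i)
    have prob: "prob_space (\<mu> (i, w))" "sets (\<mu> (i, w)) = sets borel" if "w \<in> space C" for w
      using prob_algebra_kernelD(1,2)[OF \<mu>, where x = "(i, w)"] that elim(2) by (auto simp: sp spC)
    show ?case
    proof (intro measurable_prob_algebraI measurable_subprob_algebra_generated[OF G(3,2)] prob)
      show "subprob_space (\<mu> (i, w))" if "w \<in> space C" for w
        by (intro prob_space_imp_subprob_space prob that)
      fix B assume "B \<in> G"
      with elim have "(\<lambda>w. ennreal (measure (\<mu> (i, w)) B)) \<in> borel_measurable C"
        by auto
      moreover have "emeasure (\<mu> (i, w)) B = ennreal (measure (\<mu> (i, w)) B)" if "w \<in> space C" for w
        by (intro finite_measure.emeasure_eq_measure prob_space.finite_measure prob that)
      ultimately show "(\<lambda>w. emeasure (\<mu> (i, w)) B) \<in> borel_measurable C"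
        by (simp cong: measurable_cong_simp)
    next
      \<comment> \<open>The criterion also asks for the total mass, which is constantly 1.\<close>
      have "emeasure (\<mu> (i, w)) UNIV = 1" if "w \<in> space C" for w
        using prob_space.emeasure_space_1[OF prob(1)[OF that]] sets_eq_imp_space_eq[OF prob(2)[OF that]] by simp
      then show "(\<lambda>w. emeasure (\<mu> (i, w)) UNIV) \<in> borel_measurable C"
        by (simp cong: measurable_cong_simp)
    qed auto
  qed
qed

text \<open>The absence of coalitional uncertainty is exactly the identity required by
  \<open>fubini_extension_AE_section_integral_eq\<close> for the two bounded functions
  \<open>indicator B (f z)\<close> and \<open>measure (\<mu> z) B\<close>.\<close>

lemma AE_section_set_integral_eq_kernel:
  fixes f :: "'i \<times> 'w \<Rightarrow> 'x::polish_space"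
  assumes "prob_space L" and Q: "fubini_extension L P Q"
    and f: "f \<in> Q \<rightarrow>\<^sub>M borel" and \<mu>: "\<mu> \<in> Q \<rightarrow>\<^sub>M prob_algebra borel"
    and nc: "no_coalitional_uncertainty L P f \<mu>"
    and E: "E \<in> sets P" and B: "B \<in> sets borel"
  shows "AE i in L. (LINT w:E|P. indicator B (f (i, w))) = (LINT w:E|P. measure (\<mu> (i, w)) B)"
proof -
  interpret Q: prob_space Q
    using Q by (auto simp: fubini_extension_def)
  show ?thesis
  proof (rule fubini_extension_AE_section_integral_eq[OF Q _ _ _ E,
        of "\<lambda>z. indicator B (f z)" "\<lambda>z. measure (\<mu> z) B"])
    show "integrable Q (\<lambda>z. indicator B (f z) :: real)"
      using f B by (intro Q.integrable_const_bound[of _ 1]) auto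
    show "integrable Q (\<lambda>z. measure (\<mu> z) B)"
      using integrable_mult_kernel[OF _ \<mu> B, of "\<lambda>_. 1"] by simp
    fix A assume A: "A \<in> sets L"
    \<comment> \<open>This holds for every \<open>w\<close>, even where the set on the right is not
      measurable: both sides then have the default value 0.\<close>
    have "(LINT i:A|L. indicator B (f (i, w))) = measure L {i \<in> A. f (i, w) \<in> B}" for w
    proof -
      have "(LINT i:A|L. indicator B (f (i, w)) :: real) = (\<integral>i. indicator {i \<in> A. f (i, w) \<in> B} i \<partial>L)"
        unfolding set_lebesgue_integral_def
        by (intro Bochner_Integration.integral_cong) (auto split: split_indicator)
      also have "\<dots> = measure L ({i \<in> A. f (i, w) \<in> B} \<inter> space L)"
        by simp
      also have "{i \<in> A. f (i, w) \<in> B} \<inter> space L = {i \<in> A. f (i, w) \<in> B}"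
        using sets.sets_into_space[OF A] by auto
      finally show ?thesis .
    qed
    with nc A B show "AE w in P. (LINT i:A|L. indicator B (f (i, w))) = (LINT i:A|L. measure (\<mu> (i, w)) B)"
      by (auto simp: no_coalitional_uncertainty_def elim!: eventually_mono)
  qed
qed

section \<open>Generators of the conditioning sigma-algebra and the conclusion\<close>

text \<open>The null sets are kept apart from the countable part \<open>G\<close>: identities between integrals hold
  trivially on them, although there may be uncountably many.\<close>

lemma countably_generated_mod_null_generator:
  assumes "full_subalgebra P C" "countably_generated_mod_null P C"
  obtains G where "countable G" "G \<subseteq> sets C" "Int_stable (G \<union> null_sets P)"
    "space C \<in> G" "sets C = sigma_sets (space C) (G \<union> null_sets P)"
proof -
  obtain E where E: "countable E" "E \<subseteq> sets P" "sets C = sigma_sets (space P) (E \<union> null_sets P)"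
    using assms(2) unfolding countably_generated_mod_null_def by blast
  have sp: "space C = space P" and sub: "sets C \<subseteq> sets P"
    using assms(1) by (auto simp: full_subalgebra_def subalgebra_def)
  have "E \<subseteq> Pow (space P)"
    using E(2) sets.sets_into_space by blast
  with E(1) obtain G where G: "countable G" "Int_stable G" "G \<subseteq> Pow (space P)" "space P \<in> G" "E \<subseteq> G"
    "G \<subseteq> sigma_sets (space P) E"
    by (rule countable_Int_stable_generator)
  have "sigma_sets (space P) E \<subseteq> sets C"
    unfolding E(3) by (intro sigma_sets_mono') auto
  then have GC: "G \<subseteq> sets C"
    using G by auto
  have null: "A \<inter> N \<in> null_sets P" "N \<inter> A \<in> null_sets P" if "A \<in> sets P" "N \<in> null_sets P" for A N
    using that by (auto intro: null_set_Int1 null_set_Int2)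
  have "Int_stable (G \<union> null_sets P)"
  proof (rule Int_stableI)
    fix A B assume "A \<in> G \<union> null_sets P" "B \<in> G \<union> null_sets P"
    \<comment> \<open>Members of \<open>G\<close> are measurable for \<open>P\<close>, so an
      intersection involving a null set is again a null set and stability survives the
      union.\<close>
    then consider "A \<in> G" "B \<in> G" | "A \<in> sets P" "B \<in> null_sets P" | "B \<in> sets P" "A \<in> null_sets P"
      using GC sub by auto
    then show "A \<inter> B \<in> G \<union> null_sets P"
      by cases (use null Int_stableD[OF G(2)] in auto)
  qed
  moreover have "sets C = sigma_sets (space P) (G \<union> null_sets P)"
    unfolding E(3)
  proof (rule sigma_sets_eqI)
    fix A assume "A \<in> G \<union> null_sets P"
    then show "A \<in> sigma_sets (space P) (E \<union> null_sets P)"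
      using GC E(3) by (auto intro: sigma_sets.Basic)
  qed (use G in \<open>auto intro: sigma_sets.Basic\<close>)
  ultimately show thesis
    using G GC by (intro that) (auto simp: sp)
qed

theorem theorem2:
  fixes L :: "'i measure" and P C :: "'w measure" and Q :: "('i \<times> 'w) measure"
    and f :: "'i \<times> 'w \<Rightarrow> 'x::polish_space" and \<mu> :: "'i \<times> 'w \<Rightarrow> 'x measure"
  assumes "prob_space L" and "complete_measure L" and "atomless L"
    and "prob_space P" and "complete_measure P"
    and "fubini_extension L P Q"
    and "full_subalgebra P C" and "countably_generated_mod_null P C"
    and "f \<in> Q \<rightarrow>\<^sub>M borel"
    and "regular_cond_distr Q (product_subalgebra L P C) f \<mu>"
    and "no_coalitional_uncertainty L P f \<mu>"
  shows "ess_pairwise_cond_indep L P C f"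
proof -
  have sub: "subalgebra P C"
    using assms(7) by (simp add: full_subalgebra_def)
  have \<mu>: "\<mu> \<in> product_subalgebra L P C \<rightarrow>\<^sub>M prob_algebra borel"
    using assms(10) by (simp add: regular_cond_distr_def)
  note prod = sets_product_subalgebra_subset[OF assms(1,4) sub assms(6)]
  have \<mu>Q: "\<mu> \<in> Q \<rightarrow>\<^sub>M prob_algebra borel"
    using \<mu> prod by (auto simp: measurable_def)
  obtain G where G: "countable G" "G \<subseteq> sets C" "Int_stable (G \<union> null_sets P)"
    "space C \<in> G" "sets C = sigma_sets (space C) (G \<union> null_sets P)"
    using assms(7,8) by (rule countably_generated_mod_null_generator)
  have GP: "G \<union> null_sets P \<subseteq> sets P"
    using G(2) sub by (auto simp: subalgebra_def)
  then have GC: "G \<union> null_sets P \<subseteq> Pow (space C)"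
    using sub sets.space_closed[of P] unfolding subalgebra_def by (metis order.trans)
  obtain H :: "'x set set" where H: "countable H" "Int_stable H" "UNIV \<in> H" "sets borel = sigma_sets UNIV H"
    using borel_countable_Int_stable_generator by metis
  have HB: "B \<in> sets borel" if "B \<in> H" for B
    using that by (simp add: H(4))
  note f_meas = AE_section_measurable_process[OF assms(6,9)]
  show ?thesis
    unfolding ess_pairwise_cond_indep_def
    using f_meas
  proof eventually_elim
    \<comment> \<open>Any \<open>i1\<close> with a measurable section will do; the exceptional null
      set of indices \<open>i2\<close> may depend on it.\<close>
    case (elim i1)
    define \<phi> where "\<phi> = (\<lambda>w. f (i1, w))"
    have \<phi>: "\<phi> \<in> P \<rightarrow>\<^sub>M borel"
      using elim by (simp add: \<phi>_def)
    \<comment> \<open>Only countably many triples \<open>D\<close>, \<open>B1\<close>,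
      \<open>B2\<close> occur here, so one null set of indices \<open>i2\<close> serves them
      all.\<close>
    have "AE i2 in L. \<forall>D\<in>G. \<forall>B1\<in>H. \<forall>B2\<in>H.
        (LINT w:(D \<inter> (\<phi> -` B1 \<inter> space P))|P. indicator B2 (f (i2, w))) =
        (LINT w:(D \<inter> (\<phi> -` B1 \<inter> space P))|P. measure (\<mu> (i2, w)) B2)"
      using G(1) H(1) GP HB measurable_sets[OF \<phi>]
      by (auto simp: AE_ball_countable subset_eq
          intro!: AE_section_set_integral_eq_kernel[OF assms(1,6,9) \<mu>Q assms(11)])
    then have "AE i2 in L. cond_indep_given P C \<phi> (\<lambda>w. f (i2, w))"
      using f_meas AE_section_measurable_kernel[OF assms(1,4,5,7) \<mu>]
    proof eventually_elim
      case (elim i2)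
      show ?case
      \<comment> \<open>The first rule asks for the integral identity on all of \<open>C\<close> and
        all Borel sets; the second reduces it to \<open>G \<union> null_sets P\<close> and
        \<open>H\<close>.\<close>
      proof (rule cond_indep_given_kernelI[OF assms(4) sub \<phi> elim(2,3)],
          rule set_integral_kernel_eqI[OF assms(4) sub \<phi> elim(2) measurable_from_subalg[OF sub elim(3)]
            G(5,3) GC _ H(4,2,3)])
        show "space C \<in> G \<union> null_sets P"
          using G(4) by simp
        fix D B1 B2 assume D: "D \<in> G \<union> null_sets P" and B: "B1 \<in> H" "B2 \<in> H"
        have restrict: "(LINT w:D|P. indicator B1 (\<phi> w) * h w) = (LINT w:(D \<inter> (\<phi> -` B1 \<inter> space P))|P. h w)"
          for h :: "'w \<Rightarrow> real"
          unfolding set_lebesgue_integral_def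
          by (intro Bochner_Integration.integral_cong) (auto split: split_indicator)
        show "(LINT w:D|P. indicator B1 (\<phi> w) * indicator B2 (f (i2, w))) =
            (LINT w:D|P. indicator B1 (\<phi> w) * measure (\<mu> (i2, w)) B2)"
        proof (cases "D \<in> G")
          case True
          then show ?thesis
            unfolding restrict using elim(1) B by blast
        next
          case False
          then have "AE w in P. w \<notin> D"
            using D by (auto intro: AE_not_in)
          then have "(LINT w:D|P. h w) = 0" for h :: "'w \<Rightarrow> real"
            unfolding set_lebesgue_integral_def by (intro integral_eq_zero_AE) (auto elim!: eventually_mono)
          then show ?thesis
            by simp
        qed
      qed
    qed
    then show ?case
      unfolding \<phi>_def .
  qed
qed

end
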